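(* Let $\mathcal{P}=\mathcal{I}\cup\mathcal{R}_1\cup\dots\cup\mathcal{R}_r$ be a polyomino, where $\mathcal{I}$ is a parallelogram polyomino and $\mathcal{R}_1,\dots,\mathcal{R}_r$ are parallelogram sub-polyominoes of $\mathcal{P}$, each based on $\mathcal{I}$, such that $V(\mathcal{R}_i)\cap V(\mathcal{R}_j)=\varnothing$ for $i\neq j$. Let $K$ be a field and $S=K[x_a\mid a\in V(\mathcal{P})]$. Then the set of all quadratic binomials corresponding to inner intervals of $\mathcal{P}$ forms a Gröbner basis of $I_{\mathcal{P}}$ with respect to the graded reverse lexicographic order $<$ on $S$ induced by: $x_{i,j}<x_{k,l}$ if $i<k$, or $i=k$ and $j<l$.
   Context: $\mathbb{N}$ is the set of nonnegative integers, and $(i,j)\le (k,l)$ in $\mathbb{N}^2$ means $i\le k$ and $j\le l$. For $a=(i,j)\le b=(k,l)$ put $[a,b]=\{m\in\mathbb{N}^2: a\le m\le b\}$; it is a proper interval if $i<k$ and $j<l$. The diagonal vertices of a proper interval are $a$ (lower-left) and $b$ (upper-right), and its anti-diagonal vertices are $(i,l)$ (upper-left) and $(k,j)$ (lower-right). A cell is $C=[a,a+(1,1)]$; $V(C)$ is the set of its four vertices and its edges are the four pairs of adjacent vertices. For a finite collection of cells $\mathcal{P}$, $V(\mathcal{P})=\bigcup_{C\in\mathcal{P}}V(C)$. A polyomino is a non-empty finite collection of cells in $(\mathbb{N}\setminus\{0\})^2$ such that any two of its cells $C,D$ are joined by a sequence of cells $C=C_1,\dots,C_m=D$ of the collection with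 $C_i\cap C_{i+1}$ an edge of both for all $i$. A sub-polyomino of $\mathcal{P}$ is a polyomino all of whose cells are in $\mathcal{P}$. A polyomino is horizontally convex if whenever two of its cells have lower-left vertices $(i,j)$ and $(k,j)$ with $k>i$, every cell with lower-left vertex $(l,j)$, $i\le l\le k$, belongs to it; vertically convex is defined analogously; convex means both. A parallelogram polyomino is a convex polyomino whose vertex set is a sub-lattice of $\mathbb{N}^2$. Based on: for a cell $C=[a,a+(1,1)]$ let $\operatorname{sp}(C)=\{x\in\mathbb{R}^2: a\le x\le a+(1,1)\}$, and for a collection of cells $\operatorname{sp}(\mathcal{P})=\bigcup_{C\in\mathcal{P}}\operatorname{sp}(C)$. Let $\mathcal{R}$ be a parallelogram polyomino, let $a_1=(a_{1,1},a_{1,2})$ be its left-most vertex on its lowest horizontal line (i.e. $a_{1,2}$ is the minimal second coordinate of the vertices of $\mathcal{R}$ and $a_{1,1}$ is the minimal first coordinate among vertices with second coordinate $a_{1,2}$), and let $b=\max\{v\in\mathbb{N}: (v,a_{1,2})\in V(\mathcal{R})\}$. $\mathcal{R}$ is based on a polyomino $\mathcal{Q}$ if $\operatorname{sp}(\mathcal{R})\cap\operatorname{sp}(\mathcal{Q})$ equals the closed real segment $[a_1,(b,a_{1,2})]$ (so $\mathcal{R}$ sits on top of $\mathcal{Q}$ along its bottom edge). An inner interval of $\mathcal{P}$ is a proper interval $[a,b]$ with $a,b\in V(\mathcal{P})$ all of whose cells belong to $\mathcal{P}$; the corresponding binomial is $x_ax_b-x_cx_d$, where $c,d$ are the anti-diagonal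 vertices of $[a,b]$. $I_{\mathcal{P}}\subset S$ is the ideal generated by all these binomials. *)

theory Defs
  imports
    "HOL-Library.Poly_Mapping"
    "HOL-Library.Product_Plus"
    "HOL-Library.Product_Order"
    "HOL-Analysis.Product_Vector"
    "HOL-Analysis.Line_Segment"
    "HOL-Algebra.Ideal"
begin

text \<open>The order, the intervals \<open>{a..b}\<close>, \<open>inf\<close> and \<open>sup\<close> on \<open>nat \<times> nat\<close> and on
  \<open>real \<times> real\<close> are the componentwise ones of \<^theory>\<open>HOL-Library.Product_Order\<close>.
  A cell is encoded by its lower-left vertex.\<close>

type_synonym vertex = "nat \<times> nat"
type_synonym cell = "nat \<times> nat"

definition cell_vertices :: "cell \<Rightarrow> vertex set" where
  "cell_vertices c = {c..c + (1, 1)}"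

definition cell_edges :: "cell \<Rightarrow> vertex set set" where
  "cell_edges c = {{c, c + (1, 0)}, {c, c + (0, 1)},
                   {c + (1, 0), c + (1, 1)}, {c + (0, 1), c + (1, 1)}}"

definition vertex_set :: "cell set \<Rightarrow> vertex set" where
  "vertex_set P = (\<Union>c\<in>P. cell_vertices c)"

definition adjacent_cells :: "cell \<Rightarrow> cell \<Rightarrow> bool" where
  "adjacent_cells c d \<longleftrightarrow> cell_vertices c \<inter> cell_vertices d \<in> cell_edges c \<inter> cell_edges d"

definition polyomino :: "cell set \<Rightarrow> bool" where
  "polyomino P \<longleftrightarrow> P \<noteq> {} \<and> finite P \<and>
     (\<forall>c\<in>P. cell_vertices c \<subseteq> {v. 0 < fst v \<and> 0 < snd v}) \<and>
     (\<forall>c\<in>P. \<forall>d\<in>P. \<exists>cs. cs \<noteq> [] \<and> hd cs = c \<and> last cs = d \<and> set cs \<subseteq> P \<and>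
        successively adjacent_cells cs)"

definition sub_polyomino :: "cell set \<Rightarrow> cell set \<Rightarrow> bool" where
  "sub_polyomino Q P \<longleftrightarrow> polyomino Q \<and> Q \<subseteq> P"

definition horizontally_convex :: "cell set \<Rightarrow> bool" where
  "horizontally_convex P \<longleftrightarrow>
     (\<forall>i j k. (i, j) \<in> P \<and> (k, j) \<in> P \<and> i < k \<longrightarrow> (\<forall>l. i \<le> l \<and> l \<le> k \<longrightarrow> (l, j) \<in> P))"

definition vertically_convex :: "cell set \<Rightarrow> bool" where
  "vertically_convex P \<longleftrightarrow>
     (\<forall>i j k. (i, j) \<in> P \<and> (i, k) \<in> P \<and> j < k \<longrightarrow> (\<forall>l. j \<le> l \<and> l \<le> k \<longrightarrow> (i, l) \<in> P))"

definition sublattice :: "vertex set \<Rightarrow> bool" where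
  "sublattice L \<longleftrightarrow> (\<forall>a\<in>L. \<forall>b\<in>L. inf a b \<in> L \<and> sup a b \<in> L)"

definition parallelogram_polyomino :: "cell set \<Rightarrow> bool" where
  "parallelogram_polyomino P \<longleftrightarrow>
     polyomino P \<and> horizontally_convex P \<and> vertically_convex P \<and> sublattice (vertex_set P)"

definition real_pt :: "vertex \<Rightarrow> real \<times> real" where
  "real_pt v = (real (fst v), real (snd v))"

definition sp :: "cell set \<Rightarrow> (real \<times> real) set" where
  "sp P = (\<Union>c\<in>P. {real_pt c..real_pt (c + (1, 1))})"

definition based_on :: "cell set \<Rightarrow> cell set \<Rightarrow> bool" where
  "based_on R Q \<longleftrightarrow>
     (let a12 = Min (snd ` vertex_set R);
          a11 = Min {v. (v, a12) \<in> vertex_set R};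
          b = Max {v. (v, a12) \<in> vertex_set R}
      in sp R \<inter> sp Q = closed_segment (real_pt (a11, a12)) (real_pt (b, a12)))"

text \<open>\<open>inner_interval P a b\<close> means that \<open>{a..b}\<close> is an inner interval of \<open>P\<close>.\<close>

definition inner_interval :: "cell set \<Rightarrow> vertex \<Rightarrow> vertex \<Rightarrow> bool" where
  "inner_interval P a b \<longleftrightarrow>
     fst a < fst b \<and> snd a < snd b \<and> a \<in> vertex_set P \<and> b \<in> vertex_set P \<and>
     (\<forall>c. cell_vertices c \<subseteq> {a..b} \<longrightarrow> c \<in> P)"

text \<open>Monomials in variables indexed by \<open>'v\<close> are exponent functions \<open>'v \<Rightarrow>\<^sub>0 nat\<close> of finite
  support; polynomials are finitely supported coefficient functions on monomials, with the
  convolution product of \<^theory>\<open>HOL-Library.Poly_Mapping\<close>. The ring \<open>K[x\<^sub>a | a \<in> V]\<close> is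
  carved out of the polynomials in all variables.\<close>

type_synonym 'v mon = "'v \<Rightarrow>\<^sub>0 nat"
type_synonym ('v, 'k) pol = "('v \<Rightarrow>\<^sub>0 nat) \<Rightarrow>\<^sub>0 'k"

definition monom_pol :: "'v mon \<Rightarrow> ('v, 'k::field) pol" where
  "monom_pol m = Poly_Mapping.single m 1"

definition var :: "'v \<Rightarrow> ('v, 'k::field) pol" where
  "var a = monom_pol (Poly_Mapping.single a 1)"

definition poly_ring :: "'v set \<Rightarrow> ('v, 'k::field) pol ring" where
  "poly_ring V = \<lparr>carrier = {p. \<forall>m\<in>Poly_Mapping.keys p. Poly_Mapping.keys m \<subseteq> V},
                  monoid.mult = (*), one = 1, zero = 0, add = (+)\<rparr>"

definition interval_binomial :: "vertex \<Rightarrow> vertex \<Rightarrow> (vertex, 'k::field) pol" where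
  "interval_binomial a b = var a * var b - var (fst a, snd b) * var (fst b, snd a)"

definition inner_binomials :: "cell set \<Rightarrow> (vertex, 'k::field) pol set" where
  "inner_binomials P = {interval_binomial a b | a b. inner_interval P a b}"

definition polyomino_ideal :: "cell set \<Rightarrow> (vertex, 'k::field) pol set" where
  "polyomino_ideal P = genideal (poly_ring (vertex_set P)) (inner_binomials P)"

definition mon_degree :: "'v mon \<Rightarrow> nat" where
  "mon_degree u = (\<Sum>a\<in>Poly_Mapping.keys u. Poly_Mapping.lookup u a)"

text \<open>Graded reverse lexicographic order induced by the strict total order \<open>vlt\<close> of the
  variables: in equal degree, \<open>u\<close> is smaller than \<open>v\<close> if \<open>u\<close> has the larger exponent at the
  \<^emph>\<open>smallest\<close> variable at which the exponents differ.\<close>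

definition grevlex_less :: "('v \<Rightarrow> 'v \<Rightarrow> bool) \<Rightarrow> 'v mon \<Rightarrow> 'v mon \<Rightarrow> bool" where
  "grevlex_less vlt u v \<longleftrightarrow> mon_degree u < mon_degree v \<or>
     mon_degree u = mon_degree v \<and>
     (\<exists>a. Poly_Mapping.lookup v a < Poly_Mapping.lookup u a \<and>
       (\<forall>b. vlt b a \<longrightarrow> Poly_Mapping.lookup u b = Poly_Mapping.lookup v b))"

definition vertex_less :: "vertex \<Rightarrow> vertex \<Rightarrow> bool" where
  "vertex_less v w \<longleftrightarrow> fst v < fst w \<or> fst v = fst w \<and> snd v < snd w"

text \<open>Meaningful for \<open>f \<noteq> 0\<close> only.\<close>

definition initial_mon :: "('v mon \<Rightarrow> 'v mon \<Rightarrow> bool) \<Rightarrow> ('v, 'k::field) pol \<Rightarrow> 'v mon" where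
  "initial_mon lt f =
     (THE m. m \<in> Poly_Mapping.keys f \<and> (\<forall>m'\<in>Poly_Mapping.keys f. m' \<noteq> m \<longrightarrow> lt m' m))"

definition initial_ideal ::
  "'v set \<Rightarrow> ('v mon \<Rightarrow> 'v mon \<Rightarrow> bool) \<Rightarrow> ('v, 'k::field) pol set \<Rightarrow> ('v, 'k) pol set" where
  "initial_ideal V lt F =
     genideal (poly_ring V) {monom_pol (initial_mon lt f) | f. f \<in> F \<and> f \<noteq> 0}"

definition groebner_basis ::
  "'v set \<Rightarrow> ('v mon \<Rightarrow> 'v mon \<Rightarrow> bool) \<Rightarrow> ('v, 'k::field) pol set \<Rightarrow> ('v, 'k) pol set \<Rightarrow> bool"
  where
  "groebner_basis V lt I G \<longleftrightarrow>
     finite G \<and> G \<subseteq> I \<and> 0 \<notin> G \<and> initial_ideal V lt G = initial_ideal V lt I"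

end

theory Submission
  imports Defs
begin

text \<open>
  In the given order the initial monomial of an inner interval is the product of its two
  anti-diagonal variables. Rewriting anti-diagonals of inner intervals to diagonals inside monomials
  terminates, and it is confluent as soon as it is locally confluent. Overlaps of two disjoint
  anti-diagonals, or of two anti-diagonals with a common upper-left or a common lower-right vertex,
  are always resolved. If the lower-right vertex \<open>c\<close> of one inner interval is the upper-left vertex
  of another one, the overlap is resolved when the rectangle to the lower left of \<open>c\<close> that they span
  lies in \<open>P\<close>. In a parallelogram polyomino this rectangle is present because a missing cell would
  disconnect the polyomino; in \<open>P\<close> one follows the row and the column bordering the rectangle, which
  can leave a piece \<open>R\<^sub>i\<close> only downwards through its bottom edge into \<open>I\<close>.

  Given confluence, let \<open>u\<close> be an irreducible monomial. The sum of the coefficients of \<open>f\<close> over all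
  monomials that rewrite to \<open>u\<close> vanishes on the ideal; if \<open>u\<close> were the initial monomial of
  \<open>f\<close>, it would be the only monomial of \<open>f\<close> rewriting to \<open>u\<close>, a contradiction.
\<close>

section \<open>Vertices and rectangles of cells\<close>

lemma mem_cell_vertices:
  "(x, y) \<in> cell_vertices (a, b) \<longleftrightarrow> a \<le> x \<and> x \<le> Suc a \<and> b \<le> y \<and> y \<le> Suc b"
  by (auto simp: cell_vertices_def less_eq_prod_def)

lemma mem_vertex_set:
  "(x, y) \<in> vertex_set P \<longleftrightarrow> (\<exists>a b. (a, b) \<in> P \<and> a \<le> x \<and> x \<le> Suc a \<and> b \<le> y \<and> y \<le> Suc b)"
  by (auto simp: vertex_set_def Bex_def mem_cell_vertices)

lemma corners_in_vertex_set:
  assumes "(a, b) \<in> P"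
  shows "(a, b) \<in> vertex_set P" "(Suc a, b) \<in> vertex_set P"
    "(a, Suc b) \<in> vertex_set P" "(Suc a, Suc b) \<in> vertex_set P"
  using assms unfolding mem_vertex_set by (metis le_refl le_SucI)+

text \<open>Cells are named by their lower-left vertices, so the cells inside the interval from
  \<open>(i, j)\<close> to \<open>(k, l)\<close> form a half-open box; the strict inequalities make
  the interval proper.\<close>

definition rect :: "cell set \<Rightarrow> nat \<Rightarrow> nat \<Rightarrow> nat \<Rightarrow> nat \<Rightarrow> bool" where
  "rect P i j k l \<longleftrightarrow> i < k \<and> j < l \<and> (\<forall>x\<in>{i..<k}. \<forall>y\<in>{j..<l}. (x, y) \<in> P)"

lemma rectD: "rect P i j k l \<Longrightarrow> i \<le> x \<Longrightarrow> x < k \<Longrightarrow> j \<le> y \<Longrightarrow> y < l \<Longrightarrow> (x, y) \<in> P"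
  by (simp add: rect_def)

lemma rect_less: "rect P i j k l \<Longrightarrow> i < k" "rect P i j k l \<Longrightarrow> j < l"
  by (simp_all add: rect_def)

lemma rect_sub:
  "rect P i j k l \<Longrightarrow> i \<le> i' \<Longrightarrow> i' < k' \<Longrightarrow> k' \<le> k \<Longrightarrow> j \<le> j' \<Longrightarrow> j' < l' \<Longrightarrow> l' \<le> l
    \<Longrightarrow> rect P i' j' k' l'"
  by (auto simp: rect_def)

lemma rect_vertices:
  assumes rect: "rect P i j k l"
  shows "(i, j) \<in> vertex_set P" "(k, l) \<in> vertex_set P"
    "(i, l) \<in> vertex_set P" "(k, j) \<in> vertex_set P"
proof -
  \<comment> \<open>The last column and row of cells have coordinates \<open>k - 1\<close> and
    \<open>l - 1\<close>; the truncated subtraction is exact because \<open>k\<close> and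
    \<open>l\<close> are positive.\<close>
  have kl: "Suc (k - Suc 0) = k" "Suc (l - Suc 0) = l"
    using rect_less[OF rect] by simp_all
  have "(i, j) \<in> P" "(k - 1, l - 1) \<in> P" "(i, l - 1) \<in> P" "(k - 1, j) \<in> P"
    by (rule rectD[OF rect]; use rect_less[OF rect] in simp)+
  from this[THEN corners_in_vertex_set(1)] this[THEN corners_in_vertex_set(2)]
    this[THEN corners_in_vertex_set(3)] this[THEN corners_in_vertex_set(4)]
  show "(i, j) \<in> vertex_set P" "(k, l) \<in> vertex_set P"
    "(i, l) \<in> vertex_set P" "(k, j) \<in> vertex_set P"
    by (simp_all add: kl)
qed

lemma inner_interval_iff_rect: "inner_interval P (i, j) (k, l) \<longleftrightarrow> rect P i j k l"
proof
  assume inner: "inner_interval P (i, j) (k, l)"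
  then have lt: "i < k" "j < l"
    by (auto simp: inner_interval_def)
  have "(x, y) \<in> P" if "x \<in> {i..<k}" "y \<in> {j..<l}" for x y
  proof -
    have "cell_vertices (x, y) \<subseteq> {(i, j)..(k, l)}"
      using that by (auto simp: cell_vertices_def less_eq_prod_def)
    then show ?thesis
      using inner by (simp add: inner_interval_def)
  qed
  then show "rect P i j k l"
    using lt by (simp add: rect_def)
next
  assume rect: "rect P i j k l"
  note lt = rect_less[OF rect]
  have "(i, j) \<in> vertex_set P" "(k, l) \<in> vertex_set P"
    by (rule rect_vertices[OF rect])+
  moreover have "c \<in> P" if c: "cell_vertices c \<subseteq> {(i, j)..(k, l)}" for c
  proof -
    have "c \<in> cell_vertices c" "c + (1, 1) \<in> cell_vertices c"
      by (auto simp: cell_vertices_def less_eq_prod_def)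
    then have "c \<in> {(i, j)..(k, l)}" "c + (1, 1) \<in> {(i, j)..(k, l)}"
      using c by blast+
    then have "(fst c, snd c) \<in> P"
      by (intro rectD[OF rect]) (auto simp: less_eq_prod_def)
    then show ?thesis
      by simp
  qed
  ultimately show "inner_interval P (i, j) (k, l)"
    using lt by (simp add: inner_interval_def)
qed

section \<open>Polyominoes based on a parallelogram polyomino\<close>

text \<open>The row borders the rectangle to the lower left of the vertex \<open>(p, q)\<close> from
  above, the column borders it from the right. Asking for the corner cell is enough, since a shorter
  row and column give every other cell of the rectangle.\<close>

definition corner_closed :: "cell set \<Rightarrow> bool" where
  "corner_closed P \<longleftrightarrow> (\<forall>x y p q. x < p \<longrightarrow> y < q \<longrightarrow>
     (\<forall>x'\<in>{x..<p}. (x', q) \<in> P) \<longrightarrow> (\<forall>y'\<in>{y..<q}. (p, y') \<in> P) \<longrightarrow> (x, y) \<in> P)"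

lemma corner_closedD:
  "corner_closed P \<Longrightarrow> x < p \<Longrightarrow> y < q \<Longrightarrow> \<forall>x'\<in>{x..<p}. (x', q) \<in> P \<Longrightarrow>
     \<forall>y'\<in>{y..<q}. (p, y') \<in> P \<Longrightarrow> (x, y) \<in> P"
  unfolding corner_closed_def by blast

text \<open>Both end points of an edge of the first cell lie in the second cell, which bounds its
  position. The bound shows that a path of cells cannot jump over an empty row or column.\<close>

lemma adjacent_cellsD:
  assumes "adjacent_cells (a, b) (a', b')"
  shows "a = a' \<and> b \<le> Suc b' \<and> b' \<le> Suc b \<or> b = b' \<and> a \<le> Suc a' \<and> a' \<le> Suc a"
proof -
  let ?E = "cell_vertices (a, b) \<inter> cell_vertices (a', b')"
  have "?E \<in> cell_edges (a, b)"
    using assms by (simp add: adjacent_cells_def)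
  then consider "{(a, b), (Suc a, b)} \<subseteq> ?E" | "{(a, b), (a, Suc b)} \<subseteq> ?E"
    | "{(Suc a, b), (Suc a, Suc b)} \<subseteq> ?E" | "{(a, Suc b), (Suc a, Suc b)} \<subseteq> ?E"
    unfolding cell_edges_def by (elim insertE emptyE) simp_all
  then show ?thesis
    by cases (auto simp: mem_cell_vertices)
qed

text \<open>Connectedness is contradicted later by trapping a path in a region \<open>Q\<close>; the
  invariant is carried along the list by induction.\<close>

lemma successively_invariant:
  assumes "successively r cs" "cs \<noteq> []" "set cs \<subseteq> P" "hd cs \<in> Q"
    and "\<And>c d. c \<in> P \<Longrightarrow> d \<in> P \<Longrightarrow> r c d \<Longrightarrow> c \<in> Q \<Longrightarrow> d \<in> Q"
  shows "last cs \<in> Q"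
  using assms(1-4)
proof (induction cs rule: induct_list012)
  case (3 c d cs)
  then show ?case
    using assms(5)[of c d] by simp
qed auto

text \<open>If \<open>(i, t)\<close> were missing, convexity would empty row \<open>t\<close> from
  column \<open>i\<close> leftwards and column \<open>i\<close> from row \<open>t\<close> downwards.
  As a meet, \<open>(i, t)\<close> is still a vertex, so some cell lies strictly to its lower left,
  and no path from there to \<open>(i, l)\<close> can cross the two empty rays.\<close>

lemma parallelogram_corner:
  assumes P: "parallelogram_polyomino P" and c: "(i, l) \<in> P" and d: "(s, t) \<in> P"
    and "i \<le> s" "t \<le> l"
  shows "(i, t) \<in> P"
proof (rule ccontr)
  assume nP: "(i, t) \<notin> P"
  have hc: "(x, t) \<in> P" if "(u, t) \<in> P" "u < s" "u \<le> x" "x \<le> s" for u x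
    using P d that unfolding parallelogram_polyomino_def horizontally_convex_def by blast
  have vc: "(i, y) \<in> P" if "(i, u) \<in> P" "u < l" "u \<le> y" "y \<le> l" for u y
    using P c that unfolding parallelogram_polyomino_def vertically_convex_def by blast
  have sl: "inf u v \<in> vertex_set P" if "u \<in> vertex_set P" "v \<in> vertex_set P" for u v
    using P that unfolding parallelogram_polyomino_def sublattice_def by blast
  have "t \<noteq> l" "i \<noteq> s"
    using nP c d by auto
  then have lt: "t < l" "i < s"
    using assms by auto
  have col: "(i, y) \<notin> P" if "y \<le> t" for y
    using vc[of y t] that lt nP by auto
  have row: "(x, t) \<notin> P" if "x \<le> i" for x
    using hc[of x i] that lt nP by auto
  have "(i, l) \<in> vertex_set P" "(s, t) \<in> vertex_set P"
    using c d by (simp_all add: corners_in_vertex_set)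
  then have "(i, t) \<in> vertex_set P"
    using sl[of "(i, l)" "(s, t)"] lt by (simp add: inf_prod_def inf_absorb1 inf_absorb2)
  then obtain a b where ab: "(a, b) \<in> P" "a \<le> i" "i \<le> Suc a" "b \<le> t" "t \<le> Suc b"
    by (auto simp: mem_vertex_set)
  \<comment> \<open>Of the four possible cells around the vertex \<open>(i, t)\<close>, three lie on
    the empty rays.\<close>
  then have ab': "a < i" "b < t"
    using col[of b] row[of a] by (metis le_neq_implies_less)+
  obtain cs where cs: "cs \<noteq> []" "hd cs = (a, b)" "last cs = (i, l)" "set cs \<subseteq> P"
    "successively adjacent_cells cs"
    using P ab(1) c unfolding parallelogram_polyomino_def polyomino_def by metis
  have "last cs \<in> {x. fst x < i \<and> snd x < t}"
  proof (rule successively_invariant[OF cs(5,1,4)])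
    show "hd cs \<in> {x. fst x < i \<and> snd x < t}"
      using cs ab' by simp
  next
    fix c d assume cd: "c \<in> P" "d \<in> P" "adjacent_cells c d" "c \<in> {x. fst x < i \<and> snd x < t}"
    obtain x y x' y' where xy: "c = (x, y)" "d = (x', y')"
      by (cases c, cases d)
    \<comment> \<open>A step moves one coordinate by at most one, so leaving the open quadrant means
      landing on an empty ray.\<close>
    have "x' \<le> i \<and> y' < t \<or> x' < i \<and> y' \<le> t"
      using adjacent_cellsD[of x y x' y'] cd xy by auto
    then show "d \<in> {x. fst x < i \<and> snd x < t}"
      using col[of y'] row[of x'] cd(2) xy by (cases "x' = i"; cases "y' = t") auto
  qed
  then show False
    using cs by simp
qed

section \<open>Contact between a piece and its base\<close>

lemma real_pt_mem_sp: "v \<in> vertex_set P \<Longrightarrow> real_pt v \<in> sp P"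
  by (auto simp: vertex_set_def sp_def cell_vertices_def real_pt_def less_eq_prod_def)

lemma finite_vertex_set:
  assumes "finite P"
  shows "finite (vertex_set P)"
  unfolding vertex_set_def
proof (rule finite_UN_I[OF assms])
  fix c :: cell
  have "cell_vertices c \<subseteq> {fst c..Suc (fst c)} \<times> {snd c..Suc (snd c)}"
    by (auto simp: cell_vertices_def less_eq_prod_def)
  then show "finite (cell_vertices c)"
    by (rule finite_subset) simp
qed

text \<open>The real segment is replaced here by discrete facts about the height \<open>h\<close> of
  the bottom line. For the last one, the midpoint of a bottom edge lies on the segment and hence in
  \<open>I\<close>, and the only cell of \<open>I\<close> that can contain it is the one directly
  below.\<close>

lemma based_onE:
  assumes R: "parallelogram_polyomino R" and based: "based_on R I"
  obtains h where "\<And>x y. (x, y) \<in> R \<Longrightarrow> h \<le> y"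
    and "\<And>x y. (x, y) \<in> vertex_set R \<Longrightarrow> (x, y) \<in> vertex_set I \<Longrightarrow> y = h"
    and "\<And>x. (x, h) \<in> R \<Longrightarrow> \<exists>y. h = Suc y \<and> (x, y) \<in> I"
proof -
  define h where "h = Min (snd ` vertex_set R)"
  define H where "H = {v. (v, h) \<in> vertex_set R}"
  have seg: "sp R \<inter> sp I = closed_segment (real (Min H), real h) (real (Max H), real h)"
    using based by (simp add: based_on_def h_def H_def real_pt_def Let_def)
  have fin: "finite (vertex_set R)"
    using R by (intro finite_vertex_set) (simp add: parallelogram_polyomino_def polyomino_def)
  have finH: "finite H"
    by (rule finite_subset[OF _ finite_imageI[OF fin, of fst]]) (force simp: H_def)
  have 1: "h \<le> y" if "(x, y) \<in> R" for x y
  proof -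
    have "(x, y) \<in> vertex_set R"
      using that by (rule corners_in_vertex_set)
    then show ?thesis
      unfolding h_def using fin by (force intro: Min_le)
  qed
  have seg_y: "snd z = real h" if "z \<in> sp R" "z \<in> sp I" for z
  proof -
    have "z \<in> closed_segment (real (Min H), real h) (real (Max H), real h)"
      using that seg by blast
    then show ?thesis
      by (auto simp: in_segment algebra_simps)
  qed
  have 2: "y = h" if "(x, y) \<in> vertex_set R" "(x, y) \<in> vertex_set I" for x y
    using seg_y[OF real_pt_mem_sp[OF that(1)] real_pt_mem_sp[OF that(2)]] by (simp add: real_pt_def)
  have 3: "\<exists>y. h = Suc y \<and> (x, y) \<in> I" if x: "(x, h) \<in> R" for x
  proof -
    have "x \<in> H" "Suc x \<in> H"
      using corners_in_vertex_set[OF x] by (simp_all add: H_def)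
    then have le: "Min H \<le> x" "Suc x \<le> Max H"
      using finH by auto
    then have le': "real (Min H) \<le> real x" "real x + 1 \<le> real (Max H)"
      by linarith+
    \<comment> \<open>The parameter of the midpoint \<open>(x + 1/2, h)\<close> of the bottom edge
      on the segment. The half keeps the point off the vertical grid lines, so the column of the
      cell found in \<open>I\<close> is forced.\<close>
    define u where "u = (real x + 1/2 - real (Min H)) / (real (Max H) - real (Min H))"
    have u: "0 \<le> u" "u \<le> 1"
      using le' by (auto simp: u_def)
    have "u * (real (Max H) - real (Min H)) = real x + 1/2 - real (Min H)"
      using le' by (simp add: u_def)
    then have "(real x + 1/2, real h) =
        (1 - u) *\<^sub>R (real (Min H), real h) + u *\<^sub>R (real (Max H), real h)"
      by (simp add: algebra_simps)
    then have "(real x + 1/2, real h) \<in> sp I"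
      using seg u unfolding closed_segment_def by blast
    then obtain a b where ab: "(a, b) \<in> I" "real a \<le> real x + 1/2" "real x + 1/2 \<le> real a + 1"
      "real b \<le> real h" "real h \<le> real b + 1"
      by (auto simp: sp_def real_pt_def less_eq_prod_def)
    then have a: "a = x" and b: "b = h \<or> h = Suc b"
      by linarith+
    \<comment> \<open>A cell of \<open>I\<close> in row \<open>h\<close> would share its upper
      vertices with \<open>R\<close>, above the only height where common vertices occur.\<close>
    have "b \<noteq> h"
    proof
      assume "b = h"
      then have "(x, Suc h) \<in> vertex_set I" "(x, Suc h) \<in> vertex_set R"
        using corners_in_vertex_set[OF ab(1)] corners_in_vertex_set[OF x] a by simp_all
      then show False
        using 2[of x "Suc h"] by simp
    qed
    then show ?thesis
      using a b ab(1) by auto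
  qed
  show ?thesis
    by (rule that[OF 1 2 3])
qed

text \<open>Backward induction on an interval; it carries membership in one piece leftwards along a
  row or downwards along a column.\<close>

lemma descend:
  fixes a b :: nat
  assumes "Q b" and "\<And>z. a \<le> z \<Longrightarrow> z < b \<Longrightarrow> Q (Suc z) \<Longrightarrow> Q z"
    and "a \<le> x" "x \<le> b"
  shows "Q x"
  using assms(4,3) by (induction rule: inc_induct) (use assms in auto)

section \<open>Rows and columns across the pieces\<close>

locale based_family =
  fixes P I :: "cell set" and R :: "nat \<Rightarrow> cell set" and r :: nat
  assumes P: "P = I \<union> (\<Union>n\<in>{1..r}. R n)"
    and parI: "parallelogram_polyomino I"
    and parR: "\<And>n. n \<in> {1..r} \<Longrightarrow> parallelogram_polyomino (R n)"
    and based: "\<And>n. n \<in> {1..r} \<Longrightarrow> based_on (R n) I"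
    and disj: "\<And>m n. m \<in> {1..r} \<Longrightarrow> n \<in> {1..r} \<Longrightarrow> m \<noteq> n \<Longrightarrow>
      vertex_set (R m) \<inter> vertex_set (R n) = {}"
begin

lemma P_cases:
  assumes "c \<in> P"
  obtains "c \<in> I" | n where "n \<in> {1..r}" "c \<in> R n"
  using assms P by blast

text \<open>Horizontally adjacent cells share a vertical edge. A switch from \<open>I\<close> to
  \<open>R n\<close> would make its two end points common vertices at different heights, but all
  common vertices have height \<open>h\<close>.\<close>

lemma row_I:
  assumes "\<forall>x\<in>{x..<p}. (x, q) \<in> P" and "x < p" and "(p - 1, q) \<in> I"
  shows "(x, q) \<in> I"
proof (rule descend[of "\<lambda>x. (x, q) \<in> I" "p - 1" x])
  fix z assume z: "x \<le> z" "z < p - 1" "(Suc z, q) \<in> I"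
  then have "(z, q) \<in> P"
    using assms by simp
  then show "(z, q) \<in> I"
  proof (cases rule: P_cases)
    case (2 n)
    obtain h where h: "\<And>x y. (x, y) \<in> R n \<Longrightarrow> h \<le> y"
      "\<And>x y. (x, y) \<in> vertex_set (R n) \<Longrightarrow> (x, y) \<in> vertex_set I \<Longrightarrow> y = h"
      "\<And>x. (x, h) \<in> R n \<Longrightarrow> \<exists>y. h = Suc y \<and> (x, y) \<in> I"
      by (rule based_onE[OF parR[OF 2(1)] based[OF 2(1)]]) iprover
    from h(2)[of "Suc z" q] h(2)[of "Suc z" "Suc q"] show ?thesis
      using corners_in_vertex_set[OF z(3)] corners_in_vertex_set[OF 2(2)] by simp
  qed
qed (use assms in auto)

text \<open>A switch into \<open>I\<close> is excluded by the two heights of the shared vertical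
  edge, a switch into another \<open>R m\<close> by the disjointness of the vertex sets.\<close>

lemma row_R:
  assumes n: "n \<in> {1..r}" and "\<forall>x\<in>{x..<p}. (x, q) \<in> P" and "x < p" and "(p - 1, q) \<in> R n"
  shows "(x, q) \<in> R n"
proof (rule descend[of "\<lambda>x. (x, q) \<in> R n" "p - 1" x])
  fix z assume z: "x \<le> z" "z < p - 1" "(Suc z, q) \<in> R n"
  then have "(z, q) \<in> P"
    using assms by simp
  then show "(z, q) \<in> R n"
  proof (cases rule: P_cases)
    case 1
    obtain h where h: "\<And>x y. (x, y) \<in> R n \<Longrightarrow> h \<le> y"
      "\<And>x y. (x, y) \<in> vertex_set (R n) \<Longrightarrow> (x, y) \<in> vertex_set I \<Longrightarrow> y = h"
      "\<And>x. (x, h) \<in> R n \<Longrightarrow> \<exists>y. h = Suc y \<and> (x, y) \<in> I"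
      by (rule based_onE[OF parR[OF n] based[OF n]]) iprover
    from h(2)[of "Suc z" q] h(2)[of "Suc z" "Suc q"] show ?thesis
      using corners_in_vertex_set[OF z(3)] corners_in_vertex_set[OF 1] by simp
  next
    case (2 m)
    have "(Suc z, q) \<in> vertex_set (R m)" "(Suc z, q) \<in> vertex_set (R n)"
      using 2 z by (auto intro: corners_in_vertex_set)
    then show ?thesis
      using disj[OF n 2(1)] 2 by (cases "m = n") auto
  qed
qed (use assms in auto)

text \<open>Going down from \<open>I\<close> into \<open>R n\<close> would place the shared edge on
  the bottom line of \<open>R n\<close>, with a cell of \<open>R n\<close> below that line.\<close>

lemma col_I:
  assumes "\<forall>y\<in>{y..<q}. (p, y) \<in> P" and "y < q" and "(p, q - 1) \<in> I"
  shows "(p, y) \<in> I"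
proof (rule descend[of "\<lambda>y. (p, y) \<in> I" "q - 1" y])
  fix z assume z: "y \<le> z" "z < q - 1" "(p, Suc z) \<in> I"
  then have "(p, z) \<in> P"
    using assms by simp
  then show "(p, z) \<in> I"
  proof (cases rule: P_cases)
    case (2 n)
    obtain h where h: "\<And>x y. (x, y) \<in> R n \<Longrightarrow> h \<le> y"
      "\<And>x y. (x, y) \<in> vertex_set (R n) \<Longrightarrow> (x, y) \<in> vertex_set I \<Longrightarrow> y = h"
      "\<And>x. (x, h) \<in> R n \<Longrightarrow> \<exists>y. h = Suc y \<and> (x, y) \<in> I"
      by (rule based_onE[OF parR[OF 2(1)] based[OF 2(1)]]) iprover
    have "(p, Suc z) \<in> vertex_set (R n)" "(p, Suc z) \<in> vertex_set I"
      using z 2 by (auto intro: corners_in_vertex_set)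
    then show ?thesis
      using h(1)[OF 2(2)] h(2)[of p "Suc z"] by simp
  qed
qed (use assms in auto)

text \<open>As long as the column stays at or above row \<open>h\<close>, a switch into
  \<open>I\<close> would create a common vertex strictly above the height \<open>h\<close>.\<close>

lemma col_R:
  assumes n: "n \<in> {1..r}" and "\<forall>y\<in>{y..<q}. (p, y) \<in> P" and "y < q" and "(p, q - 1) \<in> R n"
    and h: "\<And>x y. (x, y) \<in> vertex_set (R n) \<Longrightarrow> (x, y) \<in> vertex_set I \<Longrightarrow> y = h" and "h \<le> y"
  shows "(p, y) \<in> R n"
proof (rule descend[of "\<lambda>y. (p, y) \<in> R n" "q - 1" y])
  fix z assume z: "y \<le> z" "z < q - 1" "(p, Suc z) \<in> R n"
  then have "(p, z) \<in> P"
    using assms by simp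
  then show "(p, z) \<in> R n"
  proof (cases rule: P_cases)
    case 1
    have "(p, Suc z) \<in> vertex_set (R n)" "(p, Suc z) \<in> vertex_set I"
      using z 1 by (auto intro: corners_in_vertex_set)
    then show ?thesis
      using h[of p "Suc z"] z \<open>h \<le> y\<close> by simp
  next
    case (2 m)
    have "(p, Suc z) \<in> vertex_set (R m)" "(p, Suc z) \<in> vertex_set (R n)"
      using 2 z by (auto intro: corners_in_vertex_set)
    then show ?thesis
      using disj[OF n 2(1)] 2 by (cases "m = n") auto
  qed
qed (use assms in auto)

text \<open>The cells \<open>(p - 1, q)\<close> and \<open>(p, q - 1)\<close> share the vertex
  \<open>(p, q)\<close>, which restricts the pieces containing them. In each remaining case the row
  and the column are traced to their ends, and \<open>parallelogram_corner\<close> is applied inside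
  a single piece.\<close>

lemma corner_closed: "corner_closed P"
  unfolding corner_closed_def
proof (intro allI impI)
  fix x y p q :: nat
  assume lt: "x < p" "y < q"
    and row: "\<forall>x'\<in>{x..<p}. (x', q) \<in> P" and col: "\<forall>y'\<in>{y..<q}. (p, y') \<in> P"
  have "(p - 1, q) \<in> P" "(p, q - 1) \<in> P"
    using lt row col by auto
  note left = \<open>(p - 1, q) \<in> P\<close> and below = \<open>(p, q - 1) \<in> P\<close>
  have I_P: "I \<subseteq> P" and R_P: "\<And>n. n \<in> {1..r} \<Longrightarrow> R n \<subseteq> P"
    using P by auto
  have pq: "(p, q) \<in> vertex_set A" if "(p - 1, q) \<in> A \<or> (p, q - 1) \<in> A" for A
    using that lt corners_in_vertex_set[of "p - 1" q A] corners_in_vertex_set[of p "q - 1" A]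
    by auto
  from below show "(x, y) \<in> P"
  proof (cases rule: P_cases)
    case 1
    have py: "(p, y) \<in> I"
      by (rule col_I[OF col lt(2) 1])
    from left show ?thesis
    proof (cases rule: P_cases)
      case l: 1
      have "(x, q) \<in> I"
        by (rule row_I[OF row lt(1) l])
      then show ?thesis
        using parallelogram_corner[OF parI _ py, of x q] lt I_P by auto
    next
      case (2 n)
      obtain h where h: "\<And>x y. (x, y) \<in> R n \<Longrightarrow> h \<le> y"
      "\<And>x y. (x, y) \<in> vertex_set (R n) \<Longrightarrow> (x, y) \<in> vertex_set I \<Longrightarrow> y = h"
      "\<And>x. (x, h) \<in> R n \<Longrightarrow> \<exists>y. h = Suc y \<and> (x, y) \<in> I"
      by (rule based_onE[OF parR[OF 2(1)] based[OF 2(1)]]) iprover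
      \<comment> \<open>The row is the bottom row of \<open>R n\<close>, since \<open>(p, q)\<close>
        is a vertex of both pieces. It is then exchanged for the row of \<open>I\<close> directly
        beneath it.\<close>
      have "q = h"
        by (rule h(2)) (use pq 1 2 in auto)
      have "(x, q) \<in> R n"
        by (rule row_R[OF 2(1) row lt(1) 2(2)])
      then obtain z where "q = Suc z" "(x, z) \<in> I"
        using h(3)[of x] \<open>q = h\<close> by auto
      then show ?thesis
        using parallelogram_corner[OF parI _ py, of x z] lt I_P by auto
    qed
  next
    case (2 n)
    obtain h where h: "\<And>x y. (x, y) \<in> R n \<Longrightarrow> h \<le> y"
      "\<And>x y. (x, y) \<in> vertex_set (R n) \<Longrightarrow> (x, y) \<in> vertex_set I \<Longrightarrow> y = h"
      "\<And>x. (x, h) \<in> R n \<Longrightarrow> \<exists>y. h = Suc y \<and> (x, y) \<in> I"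
      by (rule based_onE[OF parR[OF 2(1)] based[OF 2(1)]]) iprover
    have "h < q"
      using h(1)[OF 2(2)] lt by linarith
    from left show ?thesis
    proof (cases rule: P_cases)
      case 1
      \<comment> \<open>The common vertex \<open>(p, q)\<close> would lie on the bottom line,
        whereas the cell \<open>(p, q - 1)\<close> of \<open>R n\<close> puts \<open>q\<close>
        strictly above it.\<close>
      have "q = h"
        by (rule h(2)) (use pq 1 2 in auto)
      then show ?thesis
        using \<open>h < q\<close> by simp
    next
      case l: (2 m)
      have "m = n"
        using disj[OF l(1) 2(1)] pq[of "R m"] pq[of "R n"] l(2) 2(2) by auto
      then have xq: "(x, q) \<in> R n"
        using row_R[OF 2(1) row lt(1)] l by simp
      show ?thesis
      proof (cases "h \<le> y")
        case True
        have "(p, y) \<in> R n"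
          by (rule col_R[OF 2(1) col lt(2) 2(2) h(2) True])
        then show ?thesis
          using parallelogram_corner[OF parR[OF 2(1)] xq, of p y] lt R_P[OF 2(1)] by auto
      next
        case False
        \<comment> \<open>The column leaves \<open>R n\<close> through its bottom. The corner
          property is used twice: in \<open>R n\<close> down to row \<open>h\<close>, then in
          \<open>I\<close> starting from the supporting row \<open>z = h - 1\<close>.\<close>
        have "\<forall>y'\<in>{h..<q}. (p, y') \<in> P"
          using col False by auto
        then have ph: "(p, h) \<in> R n"
          by (rule col_R[OF 2(1) _ \<open>h < q\<close> 2(2) h(2) order_refl])
        have xh: "(x, h) \<in> R n"
          using parallelogram_corner[OF parR[OF 2(1)] xq ph] lt \<open>h < q\<close> by simp
        obtain z where z: "h = Suc z" "(x, z) \<in> I"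
          using h(3)[OF xh] by auto
        have pz: "(p, z) \<in> I"
          using h(3)[OF ph] z by auto
        have "(p, y) \<in> I"
          by (rule col_I[of y h]) (use col False \<open>h < q\<close> z pz in auto)
        then show ?thesis
          using parallelogram_corner[OF parI z(2), of p y] lt False z I_P by auto
      qed
    qed
  qed
qed

end
section \<open>Straightening of monomials\<close>

definition joinable :: "('a \<Rightarrow> 'a \<Rightarrow> bool) \<Rightarrow> 'a \<Rightarrow> 'a \<Rightarrow> bool" where
  "joinable r x y \<longleftrightarrow> (\<exists>z. r\<^sup>*\<^sup>* x z \<and> r\<^sup>*\<^sup>* y z)"

lemma joinable_sym: "joinable r x y \<Longrightarrow> joinable r y x"
  by (auto simp: joinable_def)

text \<open>A form of Newman's lemma.\<close>

lemma normal_form_reachable: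
  fixes \<mu> :: "'a \<Rightarrow> nat"
  assumes dec: "\<And>x y. r x y \<Longrightarrow> \<mu> y < \<mu> x"
    and local_confl: "\<And>x y z. r x y \<Longrightarrow> r x z \<Longrightarrow> joinable r y z"
    and irred: "\<And>y. \<not> r u y"
  shows "r\<^sup>*\<^sup>* x y \<Longrightarrow> r\<^sup>*\<^sup>* x u \<Longrightarrow> r\<^sup>*\<^sup>* y u"
proof (induction "\<mu> x" arbitrary: x y rule: less_induct)
  case less
  show ?case
  proof (cases "x = y \<or> x = u")
    case True
    then show ?thesis
      using less.prems irred by (metis converse_rtranclpE)
  next
    case False
    then obtain y1 z where y1: "r x y1" "r\<^sup>*\<^sup>* y1 y" and z: "r x z" "r\<^sup>*\<^sup>* z u"
      using less.prems by (metis converse_rtranclpE)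
    obtain w where w: "r\<^sup>*\<^sup>* y1 w" "r\<^sup>*\<^sup>* z w"
      using local_confl[OF y1(1) z(1)] by (auto simp: joinable_def)
    have "r\<^sup>*\<^sup>* w u"
      using less.hyps[OF dec[OF z(1)] w(2) z(2)] .
    with w(1) have "r\<^sup>*\<^sup>* y1 u"
      by (rule rtranclp_trans)
    then show ?thesis
      using less.hyps[OF dec[OF y1(1)] y1(2)] by blast
  qed
qed

section \<open>The straightening relation and its peaks\<close>

abbreviation X :: "nat \<Rightarrow> nat \<Rightarrow> vertex mon" where
  "X i j \<equiv> Poly_Mapping.single (i, j) 1"

text \<open>Monomials are exponent vectors, so addition is multiplication of monomials and
  \<open>w\<close> is the common cofactor.\<close>

definition straighten :: "cell set \<Rightarrow> vertex mon \<Rightarrow> vertex mon \<Rightarrow> bool" where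
  "straighten P m m' \<longleftrightarrow> (\<exists>i j k l w. rect P i j k l \<and>
     m = w + X i l + X k j \<and> m' = w + X i j + X k l)"

lemma straightenI:
  "rect P i j k l \<Longrightarrow> m = w + X i l + X k j \<Longrightarrow> m' = w + X i j + X k l \<Longrightarrow> straighten P m m'"
  unfolding straighten_def by blast

lemma joinable_steps: "r x z \<Longrightarrow> r y z \<Longrightarrow> joinable r x y"
  by (auto simp: joinable_def)

lemma joinable_step_left: "r x y \<Longrightarrow> joinable r x y"
  by (auto simp: joinable_def)

lemma joinable_two_steps: "r x z \<Longrightarrow> r z y \<Longrightarrow> joinable r x y"
  unfolding joinable_def by (metis rtranclp.rtrancl_refl rtranclp.rtrancl_into_rtrancl)

text \<open>Apart from \<open>v\<close>, all variables sit on the grid of columns \<open>i\<close>,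
  \<open>k\<close>, \<open>k'\<close> and rows \<open>j\<close>, \<open>j'\<close>,
  \<open>l\<close>, and every rectangle used lies inside \<open>A\<close> or \<open>B\<close>. The
  assumption \<open>ord\<close> breaks the symmetry by ordering the lower-right vertices
  lexicographically.\<close>

lemma peak_same_upper_left:
  assumes A: "rect P i j k l" and B: "rect P i j' k' l" and ord: "k < k' \<or> k = k' \<and> j < j'"
  shows "joinable (straighten P) (v + X i j + X k l + X k' j') (v + X i j' + X k' l + X k j)"
    (is "joinable _ ?m1 ?m2")
proof -
  have b: "i < k" "j < l" "i < k'" "j' < l"
    using A B by (simp_all add: rect_less)
  consider "k = k'" "j < j'" | "k < k'" "j = j'" | "k < k'" "j < j'" | "k < k'" "j' < j"
    using ord by linarith
  then show ?thesis
  proof cases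
    case 1
    have "straighten P ?m2 ?m1"
      by (rule straightenI[of P i j k j' _ "v + X k' l"])
        (use 1 b in \<open>auto simp: ac_simps intro: rect_sub[OF A]\<close>)
    then show ?thesis
      by (rule joinable_sym[OF joinable_step_left])
  next
    case 2
    have "straighten P ?m1 ?m2"
      by (rule straightenI[of P k j k' l _ "v + X i j"])
        (use 2 b in \<open>auto simp: ac_simps intro: rect_sub[OF B]\<close>)
    then show ?thesis
      by (rule joinable_step_left)
  next
    case 3
    let ?z = "v + X i j + X k j' + X k' l"
    have "straighten P ?m1 ?z"
      by (rule straightenI[of P k j' k' l _ "v + X i j"])
        (use 3 b in \<open>auto simp: ac_simps intro: rect_sub[OF B]\<close>)
    moreover have "straighten P ?m2 ?z"
      by (rule straightenI[of P i j k j' _ "v + X k' l"])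
        (use 3 b in \<open>auto simp: ac_simps intro: rect_sub[OF A]\<close>)
    ultimately show ?thesis
      by (rule joinable_steps)
  next
    case 4
    \<comment> \<open>The same monomial as in the previous case, but with \<open>j' < j\<close> it
      is an intermediate stage on the way from \<open>?m1\<close> to \<open>?m2\<close>.\<close>
    let ?z = "v + X i j + X k j' + X k' l"
    have "straighten P ?m1 ?z"
      by (rule straightenI[of P k j' k' l _ "v + X i j"])
        (use 4 b in \<open>auto simp: ac_simps intro: rect_sub[OF B]\<close>)
    moreover have "straighten P ?z ?m2"
      by (rule straightenI[of P i j' k j _ "v + X k' l"])
        (use 4 b in \<open>auto simp: ac_simps intro: rect_sub[OF B]\<close>)
    ultimately show ?thesis
      by (rule joinable_two_steps)
  qed
qed

text \<open>A half turn exchanges upper-left and lower-right vertices and preserves diagonals, so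
  this is the rotated image of \<open>peak_same_upper_left\<close> with the roles of
  \<open>A\<close> and \<open>B\<close> exchanged.\<close>

lemma peak_same_lower_right:
  assumes A: "rect P i j k l" and B: "rect P i' j k l'" and ord: "i < i' \<or> i = i' \<and> l < l'"
  shows "joinable (straighten P) (v + X i j + X k l + X i' l') (v + X i' j + X k l' + X i l)"
    (is "joinable _ ?m1 ?m2")
proof -
  have b: "i < k" "j < l" "i' < k" "j < l'"
    using A B by (simp_all add: rect_less)
  consider "i = i'" "l < l'" | "i < i'" "l = l'" | "i < i'" "l < l'" | "i < i'" "l' < l"
    using ord by linarith
  then show ?thesis
  proof cases
    case 1
    have "straighten P ?m1 ?m2"
      by (rule straightenI[of P i l k l' _ "v + X i j"])
        (use 1 b in \<open>auto simp: ac_simps intro: rect_sub[OF B]\<close>)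
    then show ?thesis
      by (rule joinable_step_left)
  next
    case 2
    have "straighten P ?m2 ?m1"
      by (rule straightenI[of P i j i' l _ "v + X k l'"])
        (use 2 b in \<open>auto simp: ac_simps intro: rect_sub[OF A]\<close>)
    then show ?thesis
      by (rule joinable_sym[OF joinable_step_left])
  next
    case 3
    let ?z = "v + X i j + X i' l + X k l'"
    have "straighten P ?m1 ?z"
      by (rule straightenI[of P i' l k l' _ "v + X i j"])
        (use 3 b in \<open>auto simp: ac_simps intro: rect_sub[OF B]\<close>)
    moreover have "straighten P ?m2 ?z"
      by (rule straightenI[of P i j i' l _ "v + X k l'"])
        (use 3 b in \<open>auto simp: ac_simps intro: rect_sub[OF A]\<close>)
    ultimately show ?thesis
      by (rule joinable_steps)
  next
    case 4
    let ?z = "v + X i j + X i' l + X k l'"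
    have "straighten P ?m2 ?z"
      by (rule straightenI[of P i j i' l _ "v + X k l'"])
        (use 4 b in \<open>auto simp: ac_simps intro: rect_sub[OF A]\<close>)
    moreover have "straighten P ?z ?m1"
      by (rule straightenI[of P i' l' k l _ "v + X i j"])
        (use 4 b in \<open>auto simp: ac_simps intro: rect_sub[OF A]\<close>)
    ultimately show ?thesis
      by (rule joinable_sym[OF joinable_two_steps])
  qed
qed

text \<open>The rectangle to the lower left of \<open>(p, q)\<close> extends \<open>A\<close>
  downwards and \<open>B\<close> to the left; each enlarged rectangle permits one step to
  \<open>?z\<close>.\<close>

lemma peak_antidiagonal_chain:
  assumes cc: "corner_closed P" and A: "rect P i q p l" and B: "rect P p t s q"
  shows "joinable (straighten P) (v + X i q + X p l + X s t) (v + X p t + X s q + X i l)"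
    (is "joinable _ ?m1 ?m2")
proof -
  have b: "i < p" "q < l" "p < s" "t < q"
    using A B by (simp_all add: rect_less)
  \<comment> \<open>The bottom row of \<open>A\<close> and the left column of \<open>B\<close> are
    the border required by corner closure.\<close>
  have row: "\<forall>x\<in>{i..<p}. (x, q) \<in> P"
    by (intro ballI rectD[OF A]) (use b in auto)
  have col: "\<forall>y\<in>{t..<q}. (p, y) \<in> P"
    by (intro ballI rectD[OF B]) (use b in auto)
  have L: "(x, y) \<in> P" if "i \<le> x" "x < p" "t \<le> y" "y < q" for x y
    by (rule corner_closedD[OF cc that(2,4)]) (use row col that in auto)
  have LA: "rect P i t p l"
    unfolding rect_def
  proof (intro conjI ballI)
    fix x y assume "x \<in> {i..<p}" "y \<in> {t..<l}"
    then show "(x, y) \<in> P"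
      using L[of x y] rectD[OF A, of x y] by (cases "y < q") auto
  qed (use b in auto)
  have LB: "rect P i t s q"
    unfolding rect_def
  proof (intro conjI ballI)
    fix x y assume "x \<in> {i..<s}" "y \<in> {t..<q}"
    then show "(x, y) \<in> P"
      using L[of x y] rectD[OF B, of x y] by (cases "x < p") auto
  qed (use b in auto)
  let ?z = "v + X i t + X s q + X p l"
  have "straighten P ?m1 ?z"
    by (rule straightenI[OF LB, of _ "v + X p l"]) (auto simp: ac_simps)
  moreover have "straighten P ?m2 ?z"
    by (rule straightenI[OF LA, of _ "v + X s q"]) (auto simp: ac_simps)
  ultimately show ?thesis
    by (rule joinable_steps)
qed

text \<open>Distinct variables are coprime, so each divides the opposite cofactor. The truncated
  subtraction in the witness is exact because \<open>y\<close> has positive exponent in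
  \<open>w\<close>.\<close>

lemma add_single_eq_add_single:
  fixes w w' :: "'v mon"
  assumes eq: "w + Poly_Mapping.single x 1 = w' + Poly_Mapping.single y 1" and "x \<noteq> y"
  obtains v where "w = v + Poly_Mapping.single y 1" "w' = v + Poly_Mapping.single x 1"
proof -
  have l: "Poly_Mapping.lookup w z + (1 when x = z) = Poly_Mapping.lookup w' z + (1 when y = z)" for z
    using arg_cong[OF eq, of "\<lambda>m. Poly_Mapping.lookup m z"] by (simp add: lookup_add lookup_single)
  have "w = (w - Poly_Mapping.single y 1) + Poly_Mapping.single y 1"
  proof (rule poly_mapping_eqI)
    fix z show "Poly_Mapping.lookup w z = Poly_Mapping.lookup ((w - Poly_Mapping.single y 1) + Poly_Mapping.single y 1) z"
      using l[of z] \<open>x \<noteq> y\<close> by (auto simp: lookup_add lookup_minus lookup_single when_def split: if_splits)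
  qed
  moreover have "w' = (w - Poly_Mapping.single y 1) + Poly_Mapping.single x 1"
  proof (rule poly_mapping_eqI)
    fix z show "Poly_Mapping.lookup w' z = Poly_Mapping.lookup ((w - Poly_Mapping.single y 1) + Poly_Mapping.single x 1) z"
      using l[of z] \<open>x \<noteq> y\<close> by (auto simp: lookup_add lookup_minus lookup_single when_def split: if_splits)
  qed
  ultimately show ?thesis
    by (rule that)
qed

text \<open>Cases follow the variables shared by the two anti-diagonals. Cancelling a shared
  variable from both factorizations of \<open>m\<close> yields the common cofactor \<open>v\<close>
  that the peak lemmas start from.\<close>

lemma straighten_locally_confluent:
  assumes cc: "corner_closed P" and s1: "straighten P m m1" and s2: "straighten P m m2"
  shows "joinable (straighten P) m1 m2"
proof -
  obtain i j k l w where A: "rect P i j k l" and m: "m = w + X i l + X k j"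
    and m1: "m1 = w + X i j + X k l"
    using s1 by (auto simp: straighten_def)
  obtain i' j' k' l' w' where B: "rect P i' j' k' l'" and m': "m = w' + X i' l' + X k' j'"
    and m2: "m2 = w' + X i' j' + X k' l'"
    using s2 by (auto simp: straighten_def)
  have b: "i < k" "j < l" "i' < k'" "j' < l'"
    using A B by (simp_all add: rect_less)
  consider (same) "(i, l) = (i', l')" "(k, j) = (k', j')"
    | (ul) "(i, l) = (i', l')" "(k, j) \<noteq> (k', j')"
    | (lr) "(i, l) \<noteq> (i', l')" "(k, j) = (k', j')"
    | (chain1) "(i, l) \<noteq> (i', l')" "(k, j) \<noteq> (k', j')" "(i, l) = (k', j')"
    | (chain2) "(i, l) \<noteq> (i', l')" "(k, j) \<noteq> (k', j')" "(k, j) = (i', l')"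
    | (disj) "(i, l) \<noteq> (i', l')" "(k, j) \<noteq> (k', j')" "(i, l) \<noteq> (k', j')" "(k, j) \<noteq> (i', l')"
    by blast
  then show ?thesis
  proof cases
    case same
    have "w + (X i l + X k j) = m"
      unfolding m by (simp only: ac_simps)
    also have "m = w' + (X i l + X k j)"
      unfolding m' using same by (simp add: ac_simps)
    finally have "w = w'"
      by (rule add_right_imp_eq)
    then have "m1 = m2"
      using same m1 m2 by simp
    then show ?thesis
      by (auto simp: joinable_def)
  next
    case ul
    have "(w + X k j) + X i l = m"
      unfolding m by (simp only: ac_simps)
    also have "m = (w' + X k' j') + X i l"
      unfolding m' using ul by (simp add: ac_simps)
    finally have "w + X k j = w' + X k' j'"
      by (rule add_right_imp_eq)
    then obtain v where v: "w = v + X k' j'" "w' = v + X k j"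
      using ul(2) by (rule add_single_eq_add_single)
    have eq: "m1 = v + X i j + X k l + X k' j'" "m2 = v + X i j' + X k' l + X k j"
      using ul m1 m2 v by (simp_all add: ac_simps)
    have B: "rect P i j' k' l"
      using B ul by simp
    consider "k < k' \<or> k = k' \<and> j < j'" | "k' < k \<or> k' = k \<and> j' < j"
      using ul by fastforce
    then show ?thesis
    proof cases
      case 1
      show ?thesis
        unfolding eq by (rule peak_same_upper_left[OF A B 1])
    next
      case 2
      show ?thesis
        unfolding eq by (rule joinable_sym, rule peak_same_upper_left[OF B A 2])
    qed
  next
    case lr
    have "(w + X i l) + X k j = m"
      unfolding m by (simp only: ac_simps)
    also have "m = (w' + X i' l') + X k j"
      unfolding m' using lr by (simp add: ac_simps)
    finally have "w + X i l = w' + X i' l'"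
      by (rule add_right_imp_eq)
    then obtain v where v: "w = v + X i' l'" "w' = v + X i l"
      using lr(1) by (rule add_single_eq_add_single)
    have eq: "m1 = v + X i j + X k l + X i' l'" "m2 = v + X i' j + X k l' + X i l"
      using lr m1 m2 v by (simp_all add: ac_simps)
    have B: "rect P i' j k l'"
      using B lr by simp
    consider "i < i' \<or> i = i' \<and> l < l'" | "i' < i \<or> i' = i \<and> l' < l"
      using lr by fastforce
    then show ?thesis
    proof cases
      case 1
      show ?thesis
        unfolding eq by (rule peak_same_lower_right[OF A B 1])
    next
      case 2
      show ?thesis
        unfolding eq by (rule joinable_sym, rule peak_same_lower_right[OF B A 2])
    qed
  next
    case chain1
    have "(w + X k j) + X i l = m"
      unfolding m by (simp only: ac_simps)
    also have "m = (w' + X i' l') + X i l"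
      unfolding m' using chain1 by (simp add: ac_simps)
    finally have "w + X k j = w' + X i' l'"
      by (rule add_right_imp_eq)
    \<comment> \<open>Both coincidences at once would give
      \<open>i < k = i' < k' = i\<close>.\<close>
    moreover have "(k, j) \<noteq> (i', l')"
      using b chain1 by auto
    ultimately obtain v where v: "w = v + X i' l'" "w' = v + X k j"
      by (rule add_single_eq_add_single)
    have eq: "m1 = v + X i j + X k l + X i' l'" "m2 = v + X i' l + X i l' + X k j"
      using chain1 m1 m2 v by (simp_all add: ac_simps)
    have B: "rect P i' l i l'"
      using B chain1 by simp
    show ?thesis
      unfolding eq by (rule joinable_sym, rule peak_antidiagonal_chain[OF cc B A])
  next
    case chain2
    have "(w + X i l) + X k j = m"
      unfolding m by (simp only: ac_simps)
    also have "m = (w' + X k' j') + X k j"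
      unfolding m' using chain2 by (simp add: ac_simps)
    finally have "w + X i l = w' + X k' j'"
      by (rule add_right_imp_eq)
    moreover have "(i, l) \<noteq> (k', j')"
      using b chain2 by auto
    ultimately obtain v where v: "w = v + X k' j'" "w' = v + X i l"
      by (rule add_single_eq_add_single)
    have eq: "m1 = v + X i j + X k l + X k' j'" "m2 = v + X k j' + X k' j + X i l"
      using chain2 m1 m2 v by (simp_all add: ac_simps)
    have B: "rect P k j' k' j"
      using B chain2 by simp
    show ?thesis
      unfolding eq by (rule peak_antidiagonal_chain[OF cc A B])
  next
    case disj
    have "(w + X i l) + X k j = (w' + X i' l') + X k' j'"
      by (rule trans[OF m[symmetric] m'])
    \<comment> \<open>With no shared variable, cancelling one variable at a time shows that
      \<open>m\<close> is divisible by all four, so the two steps commute.\<close>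
    then obtain v1 where v1: "w + X i l = v1 + X k' j'" "w' + X i' l' = v1 + X k j"
      using disj(2) by (rule add_single_eq_add_single)
    obtain v2 where v2: "w = v2 + X k' j'" "v1 = v2 + X i l"
      using v1(1) disj(3) by (rule add_single_eq_add_single)
    obtain v3 where v3: "w' = v3 + X k j" "v1 = v3 + X i' l'"
      using v1(2) disj(4)[symmetric] by (rule add_single_eq_add_single)
    have "v2 + X i l = v3 + X i' l'"
      by (rule trans[OF v2(2)[symmetric] v3(2)])
    then obtain v where v: "v2 = v + X i' l'" "v3 = v + X i l"
      using disj(1) by (rule add_single_eq_add_single)
    let ?z = "v + X i j + X k l + X i' j' + X k' l'"
    have "straighten P m1 ?z"
      by (rule straightenI[OF B, of _ "v + X i j + X k l"]) (auto simp: m1 v2 v ac_simps)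
    moreover have "straighten P m2 ?z"
      by (rule straightenI[OF A, of _ "v + X i' j' + X k' l'"]) (auto simp: m2 v3 v ac_simps)
    ultimately show ?thesis
      by (rule joinable_steps)
  qed
qed

section \<open>Termination of straightening\<close>

definition weighted_degree :: "('v \<Rightarrow> nat) \<Rightarrow> 'v mon \<Rightarrow> nat" where
  "weighted_degree f m = (\<Sum>a\<in>Poly_Mapping.keys m. Poly_Mapping.lookup m a * f a)"

lemma weighted_degree_add [simp]:
  "weighted_degree f (m + m') = weighted_degree f m + weighted_degree f m'"
  unfolding weighted_degree_def
  by (rule setsum_keys_plus_distrib) (simp_all add: algebra_simps)

lemma weighted_degree_single [simp]: "weighted_degree f (Poly_Mapping.single a n) = n * f a"
  by (simp add: weighted_degree_def)

text \<open>The total degree and the termination measure are both weighted degrees, so additivity is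
  proved once.\<close>

lemma mon_degree_eq: "mon_degree m = weighted_degree (\<lambda>_. 1) m"
  by (simp add: mon_degree_def weighted_degree_def)

text \<open>Replacing the anti-diagonal of a rectangle by its diagonal decreases the sum of
  \<open>(i - j)\<^sup>2\<close> over the variables \<open>x\<^sub>i\<^sub>j\<close> of a monomial by twice the area.\<close>

definition diagonal_spread :: "vertex mon \<Rightarrow> nat" where
  "diagonal_spread = weighted_degree (\<lambda>v. nat ((int (fst v) - int (snd v))\<^sup>2))"

lemma diagonal_spread_straighten:
  assumes "straighten P m m'"
  shows "diagonal_spread m' < diagonal_spread m"
proof -
  obtain i j k l w where rect: "rect P i j k l"
    and m: "m = w + X i l + X k j" "m' = w + X i j + X k l"
    using assms unfolding straighten_def by blast
  let ?d = "\<lambda>a b. (int a - int b)\<^sup>2"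
  have "0 < (int k - int i) * (int l - int j)"
    using rect_less[OF rect] by simp
  moreover have "?d i l + ?d k j = ?d i j + ?d k l + 2 * ((int k - int i) * (int l - int j))"
    by (simp add: power2_eq_square algebra_simps)
  ultimately have "?d i j + ?d k l < ?d i l + ?d k j"
    by linarith
  \<comment> \<open>Squares are nonnegative, so the conversion by \<open>nat\<close> loses
    nothing.\<close>
  then have "int (nat (?d i j) + nat (?d k l)) < int (nat (?d i l) + nat (?d k j))"
    by simp
  then have "nat (?d i j) + nat (?d k l) < nat (?d i l) + nat (?d k j)"
    by (simp only: of_nat_less_iff)
  then show ?thesis
    by (simp add: m diagonal_spread_def)
qed

section \<open>The monomial order\<close>

lemma vertex_less_linear: "vertex_less a b \<or> a = b \<or> vertex_less b a"
  by (cases a; cases b) (auto simp: vertex_less_def)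

lemma vertex_less_trans: "vertex_less a b \<Longrightarrow> vertex_less b c \<Longrightarrow> vertex_less a c"
  by (auto simp: vertex_less_def)

text \<open>Well-foundedness supplies the smallest variable at which two monomials differ, although
  there are infinitely many variables.\<close>

lemma wf_vertex_less: "wf {(a, b). vertex_less a b}"
proof -
  have "{(a, b). vertex_less a b} = less_than <*lex*> less_than"
    by (auto simp: vertex_less_def)
  then show ?thesis
    by (simp add: wf_lex_prod)
qed

abbreviation mon_less :: "vertex mon \<Rightarrow> vertex mon \<Rightarrow> bool" where
  "mon_less \<equiv> grevlex_less vertex_less"

lemma mon_less_irrefl: "\<not> mon_less u u"
  by (auto simp: grevlex_less_def)

lemma mon_less_linear:
  assumes "u \<noteq> v"
  shows "mon_less u v \<or> mon_less v u"
proof -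
  let ?D = "{a. Poly_Mapping.lookup u a \<noteq> Poly_Mapping.lookup v a}"
  have "?D \<noteq> {}"
    using assms by (auto intro: poly_mapping_eqI)
  from wfE_min'[OF wf_vertex_less this] obtain a where a: "a \<in> ?D"
    and min: "\<And>b. (b, a) \<in> {(a, b). vertex_less a b} \<Longrightarrow> b \<notin> ?D"
    by blast
  have agree: "\<forall>b. vertex_less b a \<longrightarrow> Poly_Mapping.lookup u b = Poly_Mapping.lookup v b"
    using min by simp
  consider "mon_degree u \<noteq> mon_degree v"
    | "mon_degree u = mon_degree v" "Poly_Mapping.lookup v a < Poly_Mapping.lookup u a"
    | "mon_degree u = mon_degree v" "Poly_Mapping.lookup u a < Poly_Mapping.lookup v a"
    using a by fastforce
  then show ?thesis
  proof cases
    case 1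
    then show ?thesis
      by (simp add: grevlex_less_def) linarith
  next
    case 2
    then have "mon_less u v"
      unfolding grevlex_less_def using agree by blast
    then show ?thesis ..
  next
    case 3
    then have "mon_less v u"
      unfolding grevlex_less_def using agree by (metis (no_types))
    then show ?thesis ..
  qed
qed

lemma mon_less_trans:
  assumes uv: "mon_less u v" and vw: "mon_less v w"
  shows "mon_less u w"
proof (cases "mon_degree u = mon_degree v \<and> mon_degree v = mon_degree w")
  case True
  obtain a where a: "Poly_Mapping.lookup v a < Poly_Mapping.lookup u a"
    "\<And>b. vertex_less b a \<Longrightarrow> Poly_Mapping.lookup u b = Poly_Mapping.lookup v b"
    using uv True unfolding grevlex_less_def by auto
  obtain a' where a': "Poly_Mapping.lookup w a' < Poly_Mapping.lookup v a'"
    "\<And>b. vertex_less b a' \<Longrightarrow> Poly_Mapping.lookup v b = Poly_Mapping.lookup w b"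
    using vw True unfolding grevlex_less_def by auto
  \<comment> \<open>The smaller of the two deciding variables decides the comparison of
    \<open>u\<close> with \<open>w\<close>.\<close>
  consider "vertex_less a a'" | "a = a'" | "vertex_less a' a"
    using vertex_less_linear by blast
  then have "\<exists>c. Poly_Mapping.lookup w c < Poly_Mapping.lookup u c \<and>
      (\<forall>b. vertex_less b c \<longrightarrow> Poly_Mapping.lookup u b = Poly_Mapping.lookup w b)"
  proof cases
    case 1
    then show ?thesis
      using a a'(2)[OF 1] a'(2)[OF vertex_less_trans[OF _ 1]] by (intro exI[of _ a]) simp
  next
    case 2
    then show ?thesis
      using a a' by (intro exI[of _ a]) simp
  next
    case 3
    then show ?thesis
      using a(2)[OF 3] a(2)[OF vertex_less_trans[OF _ 3]] a' by (intro exI[of _ a']) simp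
  qed
  then show ?thesis
    using True unfolding grevlex_less_def by simp
next
  case False
  then show ?thesis
    using uv vw unfolding grevlex_less_def by linarith
qed

lemma mon_less_asym: "mon_less u v \<Longrightarrow> \<not> mon_less v u"
  using mon_less_trans mon_less_irrefl by blast

text \<open>The lower-left vertex \<open>(i, j)\<close> is the smallest of the four, and only the
  diagonal product contributes there; the larger exponent at the smallest variable makes a monomial
  smaller.\<close>

lemma mon_less_swap:
  assumes "i < k" "j < l"
  shows "mon_less (w + X i j + X k l) (w + X i l + X k j)"
proof -
  have "Poly_Mapping.lookup (w + X i l + X k j) (i, j) < Poly_Mapping.lookup (w + X i j + X k l) (i, j)"
    using assms by (simp add: lookup_add lookup_single)
  moreover have "Poly_Mapping.lookup (w + X i j + X k l) b = Poly_Mapping.lookup (w + X i l + X k j) b"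
    if "vertex_less b (i, j)" for b
    using assms that by (cases b) (auto simp: lookup_add lookup_single when_def vertex_less_def)
  ultimately show ?thesis
    unfolding grevlex_less_def by (auto simp: mon_degree_eq)
qed

lemma mon_less_straighten_rtranclp:
  "(straighten P)\<^sup>*\<^sup>* m u \<Longrightarrow> m = u \<or> mon_less u m"
proof (induction rule: rtranclp_induct)
  case (step y z)
  then have "mon_less z y"
    by (auto simp only: straighten_def intro: mon_less_swap rect_less)
  then show ?case
    using step.IH mon_less_trans by blast
qed simp

text \<open>The support is finite and nonempty and the strict order is total, so the definite
  description has exactly one candidate.\<close>

lemma initial_mon_greatest:
  assumes "f \<noteq> 0"
  shows "initial_mon mon_less f \<in> Poly_Mapping.keys f \<and>
    (\<forall>m\<in>Poly_Mapping.keys f. m \<noteq> initial_mon mon_less f \<longrightarrow> mon_less m (initial_mon mon_less f))"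
proof -
  have ne: "Poly_Mapping.keys f \<noteq> {}"
    using assms by simp
  have "\<exists>m\<in>Poly_Mapping.keys f. \<forall>m'\<in>Poly_Mapping.keys f. m' \<noteq> m \<longrightarrow> mon_less m' m"
    by (rule Finite_Set.bex_greatest_element[OF finite_keys ne])
      (auto simp: transp_on_def totalp_on_def intro: mon_less_trans dest: mon_less_linear)
  then obtain m where m: "m \<in> Poly_Mapping.keys f"
    "\<forall>m'\<in>Poly_Mapping.keys f. m' \<noteq> m \<longrightarrow> mon_less m' m"
    by blast
  have "initial_mon mon_less f = m"
    unfolding initial_mon_def
  proof (rule the_equality)
    fix m' assume m': "m' \<in> Poly_Mapping.keys f \<and> (\<forall>n\<in>Poly_Mapping.keys f. n \<noteq> m' \<longrightarrow> mon_less n m')"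
    show "m' = m"
    proof (rule ccontr)
      assume "m' \<noteq> m"
      then have "mon_less m' m" "mon_less m m'"
        using m m' by simp_all
      then show False
        using mon_less_asym by blast
    qed
  qed (use m in blast)
  then show ?thesis
    using m by simp
qed

section \<open>Interval binomials and their initial monomials\<close>

lemma var_mult_var:
  "var a * var b = (Poly_Mapping.single (Poly_Mapping.single a 1 + Poly_Mapping.single b 1) 1 :: ('v, 'k::field) pol)"
  by (simp add: var_def monom_pol_def mult_single)

lemma interval_binomial_eq:
  "(interval_binomial (i, j) (k, l) :: (vertex, 'k::field) pol) =
     Poly_Mapping.single (X i j + X k l) 1 - Poly_Mapping.single (X i l + X k j) 1"
  by (simp add: interval_binomial_def var_mult_var)

text \<open>The two monomials are strictly comparable, hence distinct, so their coefficients
  \<open>1\<close> and \<open>- 1\<close> do not cancel in any characteristic.\<close>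

lemma interval_binomial_props:
  assumes "i < k" "j < l"
  shows "(interval_binomial (i, j) (k, l) :: (vertex, 'k::field) pol) \<noteq> 0"
    and "Poly_Mapping.keys (interval_binomial (i, j) (k, l) :: (vertex, 'k) pol) =
      {X i j + X k l, X i l + X k j}"
    and "initial_mon mon_less (interval_binomial (i, j) (k, l) :: (vertex, 'k) pol) = X i l + X k j"
proof -
  let ?f = "interval_binomial (i, j) (k, l) :: (vertex, 'k) pol"
  have less: "mon_less (X i j + X k l) (X i l + X k j)"
    using mon_less_swap[OF assms, of 0] by simp
  then have ne: "X i j + X k l \<noteq> X i l + X k j"
    using mon_less_irrefl by metis
  show keys: "Poly_Mapping.keys ?f = {X i j + X k l, X i l + X k j}"
    using ne by (auto simp: interval_binomial_eq in_keys_iff lookup_minus lookup_single when_def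
        split: if_splits)
  show nz: "?f \<noteq> 0"
    using keys by auto
  show "initial_mon mon_less ?f = X i l + X k j"
  proof (rule ccontr)
    note greatest = initial_mon_greatest[OF nz, unfolded keys]
    assume neq: "initial_mon mon_less ?f \<noteq> X i l + X k j"
    have eq: "initial_mon mon_less ?f = X i j + X k l"
      using greatest neq by blast
    have "mon_less (X i l + X k j) (initial_mon mon_less ?f)"
      by (rule bspec[OF conjunct2[OF greatest], THEN mp]) (rule insertI2 singletonI neq[symmetric])+
    then show False
      using mon_less_asym[OF less] unfolding eq by contradiction
  qed
qed

section \<open>The coefficient-sum argument\<close>

lemma carrier_poly_ring:
  "p \<in> carrier (poly_ring V) \<longleftrightarrow> (\<forall>m\<in>Poly_Mapping.keys p. Poly_Mapping.keys m \<subseteq> V)"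
  by (simp add: poly_ring_def)

lemma poly_ring_ops [simp]:
  "x \<oplus>\<^bsub>poly_ring V\<^esub> y = x + y" "x \<otimes>\<^bsub>poly_ring V\<^esub> y = x * y"
  "\<zero>\<^bsub>poly_ring V\<^esub> = 0" "\<one>\<^bsub>poly_ring V\<^esub> = 1"
  by (simp_all add: poly_ring_def)

lemma zero_one_in_poly_ring:
  "(0 :: ('v, 'k::field) pol) \<in> carrier (poly_ring V)"
  "(1 :: ('v, 'k::field) pol) \<in> carrier (poly_ring V)"
  by (simp_all add: carrier_poly_ring)

lemma poly_ring_closed:
  fixes p q :: "('v, 'k::field) pol"
  assumes "p \<in> carrier (poly_ring V)" "q \<in> carrier (poly_ring V)"
  shows "p + q \<in> carrier (poly_ring V)" "p * q \<in> carrier (poly_ring V)"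
proof -
  show "p + q \<in> carrier (poly_ring V)"
    using assms keys_add[of p q] unfolding carrier_poly_ring by blast
  show "p * q \<in> carrier (poly_ring V)"
    unfolding carrier_poly_ring
  proof
    fix m assume "m \<in> Poly_Mapping.keys (p * q)"
    then obtain a b where "m = a + b" "a \<in> Poly_Mapping.keys p" "b \<in> Poly_Mapping.keys q"
      using keys_mult[of p q] by blast
    then show "Poly_Mapping.keys m \<subseteq> V"
      using assms keys_add[of a b] unfolding carrier_poly_ring by blast
  qed
qed

lemma poly_ring_uminus_closed:
  fixes p :: "('v, 'k::field) pol"
  shows "p \<in> carrier (poly_ring V) \<Longrightarrow> - p \<in> carrier (poly_ring V)"
  unfolding carrier_poly_ring by (simp add: in_keys_iff)

lemma cring_poly_ring: "cring (poly_ring V :: ('v, 'k::field) pol ring)"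
proof (rule cringI)
  show "abelian_group (poly_ring V :: ('v, 'k) pol ring)"
  proof (rule abelian_groupI)
    fix x :: "('v, 'k) pol" assume "x \<in> carrier (poly_ring V)"
    then show "\<exists>y\<in>carrier (poly_ring V). y \<oplus>\<^bsub>poly_ring V\<^esub> x = \<zero>\<^bsub>poly_ring V\<^esub>"
      by (intro bexI[of _ "- x"] poly_ring_uminus_closed) simp_all
  qed (simp_all add: poly_ring_closed zero_one_in_poly_ring add_ac)
  show "comm_monoid (poly_ring V :: ('v, 'k) pol ring)"
    by (rule comm_monoidI) (simp_all add: poly_ring_closed zero_one_in_poly_ring mult_ac)
qed (simp add: distrib_right)

text \<open>Closure under negation follows from closure under multiplication by the ring element
  \<open>- 1\<close>.\<close>

lemma ideal_poly_ringI:
  fixes K :: "('v, 'k::field) pol set"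
  assumes sub: "K \<subseteq> carrier (poly_ring V)" and zero: "0 \<in> K"
    and add: "\<And>f g. f \<in> K \<Longrightarrow> g \<in> K \<Longrightarrow> f + g \<in> K"
    and mult: "\<And>h f. h \<in> carrier (poly_ring V) \<Longrightarrow> f \<in> K \<Longrightarrow> h * f \<in> K"
  shows "ideal K (poly_ring V)"
proof -
  interpret cring "poly_ring V :: ('v, 'k) pol ring"
    by (rule cring_poly_ring)
  show ?thesis
  proof (rule idealI[OF ring_axioms])
    show "subgroup K (add_monoid (poly_ring V))"
    proof (rule add.subgroupI)
      fix f assume f: "f \<in> K"
      then have carr: "f \<in> carrier (poly_ring V)" "- f \<in> carrier (poly_ring V)"
        using sub by (auto intro: poly_ring_uminus_closed)
      have "\<ominus>\<^bsub>poly_ring V\<^esub> f = - f"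
        by (rule minus_equality) (use carr in simp_all)
      also have "- f = (- 1) * f"
        by simp
      also have "\<dots> \<in> K"
        by (rule mult[OF _ f]) (intro poly_ring_uminus_closed zero_one_in_poly_ring)
      finally show "\<ominus>\<^bsub>poly_ring V\<^esub> f \<in> K" .
    next
      show "f \<oplus>\<^bsub>poly_ring V\<^esub> g \<in> K" if "f \<in> K" "g \<in> K" for f g
        using add that by simp
    qed (use sub zero in auto)
  next
    fix f h :: "('v, 'k) pol" assume fh: "f \<in> K" "h \<in> carrier (poly_ring V)"
    show "h \<otimes>\<^bsub>poly_ring V\<^esub> f \<in> K"
      using mult[OF fh(2,1)] by simp
    show "f \<otimes>\<^bsub>poly_ring V\<^esub> h \<in> K"
      using mult[OF fh(2,1)] by (simp add: mult.commute)
  qed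
qed

lemma genideal_mono: "S \<subseteq> T \<Longrightarrow> genideal A S \<subseteq> genideal A T"
  unfolding genideal_def by blast

lemma subset_genideal: "S \<subseteq> genideal A S"
  unfolding genideal_def by blast

lemma genideal_subset: "ideal K A \<Longrightarrow> S \<subseteq> K \<Longrightarrow> genideal A S \<subseteq> K"
  unfolding genideal_def by blast

text \<open>The linear functional with value 1 on the monomials in \<open>C\<close> and 0 on all
  others. Summing over the support keeps it finite for infinite \<open>C\<close>.\<close>

definition coeff_sum :: "'v mon set \<Rightarrow> ('v, 'k::field) pol \<Rightarrow> 'k" where
  "coeff_sum C f = (\<Sum>m\<in>Poly_Mapping.keys f. if m \<in> C then Poly_Mapping.lookup f m else 0)"

lemma coeff_sum_zero [simp]: "coeff_sum C 0 = 0"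
  by (simp add: coeff_sum_def)

lemma coeff_sum_single [simp]: "coeff_sum C (Poly_Mapping.single m c) = (if m \<in> C then c else 0)"
  by (simp add: coeff_sum_def)

lemma coeff_sum_add: "coeff_sum C (f + g) = coeff_sum C f + coeff_sum C g"
  unfolding coeff_sum_def by (rule setsum_keys_plus_distrib) simp_all

lemma update_eq_single_add:
  assumes "a \<notin> Poly_Mapping.keys f"
  shows "Poly_Mapping.update a b f = Poly_Mapping.single a b + f"
  using assms
  by (intro poly_mapping_eqI) (auto simp: lookup_update lookup_add lookup_single when_def in_keys_iff)

text \<open>By linearity in \<open>h\<close> a single term suffices. Its product with the binomial
  has coefficients \<open>c\<close> and \<open>- c\<close> at two monomials that are both inside or
  both outside \<open>C\<close>.\<close>

lemma coeff_sum_mult_interval_binomial: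
  fixes h :: "(vertex, 'k::field) pol"
  assumes C: "\<And>w. w + (X i j + X k l) \<in> C \<longleftrightarrow> w + (X i l + X k j) \<in> C"
  shows "coeff_sum C (h * interval_binomial (i, j) (k, l)) = 0"
proof (induction h rule: update_induct)
  case (update h w c)
  let ?s = "Poly_Mapping.single :: _ \<Rightarrow> 'k \<Rightarrow> _"
  have "?s w c * interval_binomial (i, j) (k, l) =
      ?s (w + (X i j + X k l)) c + ?s (w + (X i l + X k j)) (- c)"
    by (simp add: interval_binomial_eq algebra_simps mult_single single_uminus)
  then have "coeff_sum C (?s w c * interval_binomial (i, j) (k, l)) = 0"
    using C[of w] by (simp add: coeff_sum_add)
  then show ?case
    using update by (simp add: update_eq_single_add distrib_right coeff_sum_add)
qed simp

text \<open>Invariance of \<open>C\<close> under straightening makes the functional vanish on all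
  multiples of the generators. An ideal \<open>K\<close> of such polynomials contains the
  generators, hence the generated ideal.\<close>

lemma coeff_sum_polyomino_ideal:
  fixes f :: "(vertex, 'k::field) pol"
  assumes f: "f \<in> polyomino_ideal P"
    and C: "\<And>m m'. straighten P m m' \<Longrightarrow> m \<in> C \<longleftrightarrow> m' \<in> C"
  shows "coeff_sum C f = 0" "f \<in> carrier (poly_ring (vertex_set P))"
proof -
  let ?A = "poly_ring (vertex_set P) :: (vertex, 'k) pol ring"
  \<comment> \<open>Quantifying over all multipliers \<open>h\<close> makes \<open>K\<close> an ideal for free.\<close>
  define K where "K = {f \<in> carrier ?A. \<forall>h. coeff_sum C (h * f) = 0}"
  have "ideal K ?A"
  proof (rule ideal_poly_ringI)
    show "f + g \<in> K" if "f \<in> K" "g \<in> K" for f g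
      using that by (simp add: K_def poly_ring_closed distrib_left coeff_sum_add)
    show "h * f \<in> K" if "h \<in> carrier ?A" "f \<in> K" for h f
      using that by (simp add: K_def poly_ring_closed flip: mult.assoc)
  qed (auto simp: K_def carrier_poly_ring)
  moreover have "inner_binomials P \<subseteq> K"
  proof
    fix g :: "(vertex, 'k) pol" assume "g \<in> inner_binomials P"
    then obtain i j k l where g: "g = interval_binomial (i, j) (k, l)" and rect: "rect P i j k l"
      by (auto simp: inner_binomials_def inner_interval_iff_rect)
    have "coeff_sum C (h * g) = 0" for h
      unfolding g
    proof (rule coeff_sum_mult_interval_binomial)
      fix w
      have "straighten P (w + (X i l + X k j)) (w + (X i j + X k l))"
        by (rule straightenI[OF rect, of _ w]) (simp_all only: add.assoc)
      then show "w + (X i j + X k l) \<in> C \<longleftrightarrow> w + (X i l + X k j) \<in> C"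
        using C by blast
    qed
    moreover have "g \<in> carrier ?A"
      using rect_vertices[OF rect] keys_add[of "X i j" "X k l"] keys_add[of "X i l" "X k j"]
      unfolding g carrier_poly_ring interval_binomial_props(2)[OF rect_less[OF rect]] by auto
    ultimately show "g \<in> K"
      by (simp add: K_def)
  qed
  ultimately have "f \<in> K"
    using f genideal_subset unfolding polyomino_ideal_def by blast
  then show "coeff_sum C f = 0" "f \<in> carrier ?A"
    \<comment> \<open>The multiplier \<open>1\<close> recovers the claim for \<open>f\<close>
      itself.\<close>
    using spec[of "\<lambda>h. coeff_sum C (h * f) = 0" 1] by (simp_all add: K_def)
qed

lemma initial_mon_reducible:
  fixes f :: "(vertex, 'k::field) pol"
  assumes cc: "corner_closed P" and f: "f \<in> polyomino_ideal P" "f \<noteq> 0"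
  shows "\<exists>m. straighten P (initial_mon mon_less f) m"
proof (rule ccontr)
  define u where "u = initial_mon mon_less f"
  assume "\<nexists>m. straighten P (initial_mon mon_less f) m"
  then have irred: "\<And>m. \<not> straighten P u m"
    by (simp add: u_def)
  define C where "C = {m. (straighten P)\<^sup>*\<^sup>* m u}"
  \<comment> \<open>Forward invariance is confluence towards the irreducible \<open>u\<close>;
    backward invariance prepends one step.\<close>
  have C: "m \<in> C \<longleftrightarrow> m' \<in> C" if s: "straighten P m m'" for m m'
  proof
    assume "m \<in> C"
    then show "m' \<in> C"
      using normal_form_reachable[of "straighten P" diagonal_spread u m m']
        diagonal_spread_straighten straighten_locally_confluent[OF cc] irred s
      unfolding C_def by blast
  next
    assume "m' \<in> C"
    then show "m \<in> C"
      using s unfolding C_def by (simp add: converse_rtranclp_into_rtranclp)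
  qed
  have u: "u \<in> Poly_Mapping.keys f"
    "\<And>m. m \<in> Poly_Mapping.keys f \<Longrightarrow> m \<noteq> u \<Longrightarrow> mon_less m u"
    using initial_mon_greatest[OF f(2)] by (auto simp: u_def)
  \<comment> \<open>Straightening only lowers monomials, so any other monomial reducing to
    \<open>u\<close> exceeds \<open>u\<close>, which is already the largest in the support.\<close>
  have "m \<in> C \<longleftrightarrow> m = u" if "m \<in> Poly_Mapping.keys f" for m
    using u(2)[OF that] mon_less_straighten_rtranclp[of P m u] mon_less_asym
    by (auto simp: C_def)
  then have "coeff_sum C f = (\<Sum>m\<in>Poly_Mapping.keys f. if m = u then Poly_Mapping.lookup f m else 0)"
    unfolding coeff_sum_def by (intro sum.cong) auto
  also have "\<dots> = Poly_Mapping.lookup f u"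
    using u(1) by simp
  finally have "coeff_sum C f \<noteq> 0"
    using u(1) by (simp add: in_keys_iff)
  then show False
    using coeff_sum_polyomino_ideal(1)[OF f(1) C] by blast
qed

text \<open>Reducibility of an initial monomial says that it is a multiple of an anti-diagonal
  product, which is the initial monomial of a generator.\<close>

theorem groebner_basis_inner_binomials:
  assumes fin: "finite (vertex_set P)" and cc: "corner_closed P"
  shows "groebner_basis (vertex_set P) mon_less
    (polyomino_ideal P :: (vertex, 'k::field) pol set) (inner_binomials P)"
proof -
  let ?A = "poly_ring (vertex_set P) :: (vertex, 'k) pol ring"
  let ?G = "inner_binomials P :: (vertex, 'k) pol set"
  let ?I = "polyomino_ideal P :: (vertex, 'k) pol set"
  have G: "\<exists>i j k l. g = interval_binomial (i, j) (k, l) \<and> rect P i j k l" if "g \<in> ?G" for g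
    using that by (auto simp: inner_binomials_def inner_interval_iff_rect)
  have "?G \<subseteq> (\<lambda>(a, b). interval_binomial a b) ` (vertex_set P \<times> vertex_set P)"
    by (auto simp: inner_binomials_def inner_interval_def)
  then have "finite ?G"
    by (rule finite_subset) (simp add: fin)
  moreover have "0 \<notin> ?G"
    using G interval_binomial_props(1)[where 'k='k] rect_less by metis
  moreover have GI: "?G \<subseteq> ?I"
    unfolding polyomino_ideal_def by (rule subset_genideal)
  moreover have "initial_ideal (vertex_set P) mon_less ?G = initial_ideal (vertex_set P) mon_less ?I"
  proof
    show "initial_ideal (vertex_set P) mon_less ?G \<subseteq> initial_ideal (vertex_set P) mon_less ?I"
      unfolding initial_ideal_def by (rule genideal_mono) (use GI in blast)
    \<comment> \<open>A generated ideal is an intersection, so the argument is run in an arbitrary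
      ideal \<open>J\<close> containing the initial monomials of the binomials.\<close>
    have "monom_pol (initial_mon mon_less f) \<in> J"
      if J: "ideal J ?A" and gens: "{monom_pol (initial_mon mon_less g) | g. g \<in> ?G \<and> g \<noteq> 0} \<subseteq> J"
        and f: "f \<in> ?I" "f \<noteq> 0" for J f
    proof -
      obtain i j k l w where rect: "rect P i j k l"
        and im: "initial_mon mon_less f = w + X i l + X k j"
        using initial_mon_reducible[OF cc f] unfolding straighten_def by blast
      note lt = rect_less[OF rect]
      have "interval_binomial (i, j) (k, l) \<in> ?G"
        using rect inner_interval_iff_rect unfolding inner_binomials_def by blast
      then have "monom_pol (initial_mon mon_less (interval_binomial (i, j) (k, l) :: (vertex, 'k) pol)) \<in> J"
        using gens interval_binomial_props(1)[OF lt, where 'k='k] by blast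
      then have "monom_pol (X i l + X k j) \<in> J"
        by (simp only: interval_binomial_props(3)[OF lt])
      \<comment> \<open>The cofactor must belong to the ring on \<open>vertex_set P\<close>; it does
        because it divides a monomial of \<open>f\<close>.\<close>
      moreover have "Poly_Mapping.keys w \<subseteq> vertex_set P"
      proof -
        have "Poly_Mapping.keys (w + X i l + X k j) \<subseteq> vertex_set P"
          \<comment> \<open>\<open>UNIV\<close> is trivially invariant under straightening, which
            leaves the carrier membership of \<open>f\<close>.\<close>
          using coeff_sum_polyomino_ideal(2)[OF f(1), of UNIV] initial_mon_greatest[OF f(2)] im
          unfolding carrier_poly_ring by auto
        moreover have "Poly_Mapping.keys w \<subseteq> Poly_Mapping.keys (w + X i l + X k j)"
          by (auto simp: in_keys_iff lookup_add)
        ultimately show ?thesis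
          by blast
      qed
      then have "monom_pol w \<in> carrier ?A"
        by (simp add: carrier_poly_ring monom_pol_def)
      ultimately have "monom_pol w \<otimes>\<^bsub>?A\<^esub> monom_pol (X i l + X k j) \<in> J"
        by (rule ideal.I_l_closed[OF J])
      then show ?thesis
        by (simp add: im monom_pol_def mult_single add.assoc)
    qed
    then have "{monom_pol (initial_mon mon_less f) | f. f \<in> ?I \<and> f \<noteq> 0} \<subseteq> J"
      if "ideal J ?A" "{monom_pol (initial_mon mon_less g) | g. g \<in> ?G \<and> g \<noteq> 0} \<subseteq> J" for J
      using that by blast
    then show "initial_ideal (vertex_set P) mon_less ?I \<subseteq> initial_ideal (vertex_set P) mon_less ?G"
      unfolding initial_ideal_def genideal_def by (intro Inter_anti_mono) blast
  qed
  ultimately show ?thesis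
    by (simp add: groebner_basis_def)
qed

section \<open>From corner closure to the Groebner basis of the composite polyomino\<close>

theorem proposition4p11:
  fixes P I :: "cell set" and R :: "nat \<Rightarrow> cell set" and r :: nat
  assumes "polyomino P"
    and "P = I \<union> (\<Union>i\<in>{1..r}. R i)"
    and "parallelogram_polyomino I"
    and "\<forall>i\<in>{1..r}. parallelogram_polyomino (R i) \<and> sub_polyomino (R i) P \<and> based_on (R i) I"
    and "\<forall>i\<in>{1..r}. \<forall>j\<in>{1..r}. i \<noteq> j \<longrightarrow> vertex_set (R i) \<inter> vertex_set (R j) = {}"
  shows "groebner_basis (vertex_set P) (grevlex_less vertex_less)
           (polyomino_ideal P :: (vertex, 'k::field) pol set) (inner_binomials P)"
proof (rule groebner_basis_inner_binomials)
  show "finite (vertex_set P)"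
    using assms(1) by (intro finite_vertex_set) (simp add: polyomino_def)
  interpret based_family P I R r
    by unfold_locales (use assms in blast)+
  show "corner_closed P"
    by (rule corner_closed)
qed

end
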